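(* Fix nonnegative integers $m,d$. Let $G(x,y,z_{-d},\dots,z_0,z_1,\dots)=\sum_{P\in\mathcal{A}_{m,d}}x^{\mathrm{size}(P)}y^{\mathrm{pa}(P)}\prod_{i\ge -d}z_i^{\phi_i(P)}$ and $g(x,z_{-d},\dots)=G(x,1,z_{-d},\dots)$. Then \[ \frac{1-x}{1-xy}\,g\!\left(\frac{x(1-x)}{1-xy},z_{-d},z_{-d+1},\dots\right)=G(x,y,z_{-d},z_{-d+1},\dots). \]
   Context: $\mathcal{A}_{m,d}$ is the set of lattice paths of upsteps $U=(1,1)$, downsteps $D=(1,-1)$ and flatsteps $F=(2,0)$ that start at $(0,m)$, end on the $x$-axis, and whose lowest point is at level $-d$. The size of a path is (number of flatsteps) + (number of downsteps); $\phi_i(P)$ is the number of flatsteps at level $i$. An ascent is a maximal subpath of the form $U^k$ ($k\ge1$); a pyramid is a maximal subpath of the form $U^kD^k$ ($k\ge1$); a pyramid ascent is an ascent that is the first half of a pyramid; $\mathrm{pa}(P)$ is the number of pyramid ascents. All series are formal power series. *)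

theory Defs
  imports
    "HOL-Computational_Algebra.Computational_Algebra"
    "HOL-Library.Poly_Mapping"
begin

datatype step = Up | Down | Flat

fun step_vec :: "step \<Rightarrow> int \<times> int" where
  "step_vec Up = (1, 1)"
| "step_vec Down = (1, - 1)"
| "step_vec Flat = (2, 0)"

text \<open>A lattice path is given by its sequence of steps; the starting point \<open>(0, m)\<close> is a
  separate parameter. \<open>level m P k\<close> is the ordinate of the vertex reached after the first
  \<open>k\<close> steps.\<close>

type_synonym path = "step list"

definition level :: "nat \<Rightarrow> path \<Rightarrow> nat \<Rightarrow> int" where
  "level m P k = int m + (\<Sum>s\<leftarrow>take k P. snd (step_vec s))"

definition paths :: "nat \<Rightarrow> nat \<Rightarrow> path set" where
  "paths m d =
     {P. level m P (length P) = 0 \<and> Min (level m P ` {0..length P}) = - int d}"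

definition path_size :: "path \<Rightarrow> nat" where
  "path_size P = count_list P Flat + count_list P Down"

definition flats_at :: "nat \<Rightarrow> int \<Rightarrow> path \<Rightarrow> nat" where
  "flats_at m i P = card {k. k < length P \<and> P ! k = Flat \<and> level m P k = i}"

text \<open>An occurrence of a subpath of \<open>P\<close> is a pair \<open>i \<le> j \<le> length P\<close>, standing for the
  steps with index in \<open>{i..<j}\<close>. Maximality is with respect to inclusion among the
  occurrences of subpaths of the prescribed form.\<close>

definition subpath :: "path \<Rightarrow> nat \<Rightarrow> nat \<Rightarrow> path" where
  "subpath P i j = take (j - i) (drop i P)"

definition maximal_subpath :: "(path \<Rightarrow> bool) \<Rightarrow> path \<Rightarrow> nat \<Rightarrow> nat \<Rightarrow> bool" where
  "maximal_subpath Q P i j \<longleftrightarrow>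
     i \<le> j \<and> j \<le> length P \<and> Q (subpath P i j) \<and>
     (\<forall>i' j'. i' \<le> i \<and> j \<le> j' \<and> j' \<le> length P \<and> Q (subpath P i' j') \<longrightarrow> i' = i \<and> j' = j)"

definition ascent :: "path \<Rightarrow> nat \<Rightarrow> nat \<Rightarrow> bool" where
  "ascent = maximal_subpath (\<lambda>w. \<exists>k\<ge>1. w = replicate k Up)"

definition pyramid :: "path \<Rightarrow> nat \<Rightarrow> nat \<Rightarrow> bool" where
  "pyramid = maximal_subpath (\<lambda>w. \<exists>k\<ge>1. w = replicate k Up @ replicate k Down)"

definition pyramid_ascent :: "path \<Rightarrow> nat \<Rightarrow> nat \<Rightarrow> bool" where
  "pyramid_ascent P i j \<longleftrightarrow> ascent P i j \<and> pyramid P i (j + (j - i))"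

definition pa :: "path \<Rightarrow> nat" where
  "pa P = card {(i, j). pyramid_ascent P i j}"

text \<open>\<open>zpoly\<close> is the polynomial ring over the integers in the indeterminates \<open>z\<^sub>i\<close>, one for
  each integer \<open>i\<close>: an exponent vector is a finitely supported map from indices to exponents,
  and a polynomial is a finitely supported map from exponent vectors to coefficients.
  There are finitely many paths of each size, so the coefficient of \<open>x\<^sup>n\<close> in \<open>G\<close> is a polynomial
  in \<open>y\<close> and the \<open>z\<^sub>i\<close>; hence \<open>G\<close> is an element of \<open>zpoly poly fps\<close>, where \<open>poly\<close> adjoins \<open>y\<close>
  and \<open>fps\<close> adjoins \<open>x\<close>.\<close>

type_synonym zpoly = "(int \<Rightarrow>\<^sub>0 nat) \<Rightarrow>\<^sub>0 int"

definition zvar :: "int \<Rightarrow> zpoly" where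
  "zvar i = Poly_Mapping.single (Poly_Mapping.single i 1) 1"

definition yvar :: "zpoly poly" where
  "yvar = [:0, 1:]"

text \<open>The product over all \<open>i \<ge> - d\<close> is restricted to its finitely many factors with nonzero
  exponent.\<close>

definition flat_weight :: "nat \<Rightarrow> nat \<Rightarrow> path \<Rightarrow> zpoly" where
  "flat_weight m d P = (\<Prod>i | - int d \<le> i \<and> flats_at m i P \<noteq> 0. zvar i ^ flats_at m i P)"

definition G :: "nat \<Rightarrow> nat \<Rightarrow> zpoly poly fps" where
  "G m d = Abs_fps (\<lambda>n. \<Sum>P | P \<in> paths m d \<and> path_size P = n. yvar ^ pa P * [:flat_weight m d P:])"

definition g :: "nat \<Rightarrow> nat \<Rightarrow> zpoly fps" where
  "g m d = Abs_fps (\<lambda>n. poly (fps_nth (G m d) n) 1)"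

text \<open>The inclusion of series in \<open>x\<close> and the \<open>z\<^sub>i\<close> into series in \<open>x\<close>, \<open>y\<close> and the \<open>z\<^sub>i\<close>.\<close>

definition incl_y :: "zpoly fps \<Rightarrow> zpoly poly fps" where
  "incl_y f = Abs_fps (\<lambda>n. [:fps_nth f n:])"

text \<open>The series \<open>1 / (1 - x y)\<close>. The coefficient ring is not a field, so the inverse is taken
  with the inverse \<open>1\<close> of the constant term given explicitly.\<close>

definition inv_1_minus_xy :: "zpoly poly fps" where
  "inv_1_minus_xy = fps_right_inverse (1 - fps_X * fps_const yvar) 1"

lemma inv_1_minus_xy: "(1 - fps_X * fps_const yvar) * inv_1_minus_xy = 1"
  unfolding inv_1_minus_xy_def by (rule fps_right_inverse) simp

lemma finite_paths_of_size: "finite {P \<in> paths m d. path_size P = n}"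
proof (rule finite_subset)
  have rise: "(\<Sum>s\<leftarrow>P. snd (step_vec s)) = int (count_list P Up) - int (count_list P Down)" for P
  proof (induction P)
    case (Cons s P)
    then show ?case by (cases s) auto
  qed simp
  have len: "length P = count_list P Up + count_list P Down + count_list P Flat" for P
  proof (induction P)
    case (Cons s P)
    then show ?case by (cases s) auto
  qed simp
  show "{P \<in> paths m d. path_size P = n} \<subseteq> {P. set P \<subseteq> {Up, Down, Flat} \<and> length P \<le> 2 * n}"
  proof clarify
    fix P assume "P \<in> paths m d" "n = path_size P"
    then have "length P \<le> 2 * path_size P"
      using rise[of P] len[of P] by (simp add: paths_def level_def path_size_def)
    moreover have "set P \<subseteq> {Up, Down, Flat}"
      using step.exhaust by blast
    ultimately show "set P \<subseteq> {Up, Down, Flat} \<and> length P \<le> 2 * path_size P" by blast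
  qed
  show "finite {P. set P \<subseteq> {Up, Down, Flat} \<and> length P \<le> 2 * n}"
    by (rule finite_lists_length_le) simp
qed

lemma finite_flat_levels: "finite {i. - int d \<le> i \<and> flats_at m i P \<noteq> 0}"
proof (rule finite_subset)
  show "{i. - int d \<le> i \<and> flats_at m i P \<noteq> 0} \<subseteq> level m P ` {..<length P}"
    by (auto simp: flats_at_def card_eq_0_iff)
qed simp

end

theory Submission
  imports Defs
begin

text \<open>For a weight \<open>w\<close> on paths that does not change when a subpath \<open>U\<^sup>k D\<^sup>k\<close> is inserted, let
  \<open>F(w) = \<Sum>\<^sub>P x\<^bsup>size P\<^esup> y\<^bsup>pa P\<^esup> w(P)\<close>. Write a path that does not consist of upsteps only as
  \<open>P = U\<^sup>a s Q\<close> with \<open>s \<noteq> U\<close>. Its first ascent is a pyramid ascent iff \<open>P = U\<^sup>a D\<^sup>a R\<close> with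
  \<open>a \<ge> 1\<close>, and then \<open>pa Q = pa R\<close>; hence \<open>y\<^bsup>pa P\<^esup>\<close> equals \<open>y\<^bsup>pa Q\<^esup>\<close>, plus \<open>(y - 1) y\<^bsup>pa R\<^esup>\<close> in the
  pyramid case. By invariance of \<open>w\<close> the extra terms sum to \<open>(y - 1) x / (1 - x) F(w)\<close>, so that
  \<open>F(w) = C (\<Sum>\<^sub>a w(U\<^sup>a) + x \<Sum>\<^sub>a\<^sub>,\<^sub>s F(w(U\<^sup>a s \<cdot>)))\<close> with \<open>C = (1 - x) / (1 - x y)\<close>. Iterating this
  collects one factor \<open>C\<close> for each unit of size and one more at the end:
  \<open>F(w) = \<Sum>\<^sub>P C (x C)\<^bsup>size P\<^esup> w(P)\<close>.\<close>

section \<open>Rise and size of paths, and finiteness when both are fixed\<close>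

definition rise :: "path \<Rightarrow> int" where
  "rise P = (\<Sum>s\<leftarrow>P. snd (step_vec s))"

text \<open>The recursion runs over all paths of given rise and size. The condition on the lowest
  level is moved into the weight, so that removing a prefix only shifts \<open>r\<close> and
  \<open>n\<close>.\<close>

definition rise_size_paths :: "int \<Rightarrow> nat \<Rightarrow> path set" where
  "rise_size_paths r n = {P. rise P = r \<and> path_size P = n}"

lemma rise_simps [simp]:
  "rise [] = 0" "rise (s # P) = snd (step_vec s) + rise P" "rise (P @ Q) = rise P + rise Q"
  "rise (replicate k s) = int k * snd (step_vec s)"
  by (simp_all add: rise_def sum_list_replicate)

lemma path_size_simps [simp]:
  "path_size [] = 0" "path_size (Up # P) = path_size P"
  "path_size (Down # P) = Suc (path_size P)" "path_size (Flat # P) = Suc (path_size P)"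
  "path_size (P @ Q) = path_size P + path_size Q"
  by (simp_all add: path_size_def)

lemma path_size_replicate [simp]:
  "path_size (replicate k Up) = 0" "path_size (replicate k Down) = k"
  by (induction k) auto

lemma rise_eq: "rise P = int (length P) - int (count_list P Flat) - 2 * int (count_list P Down)"
proof (induction P)
  case (Cons s P)
  then show ?case by (cases s) auto
qed simp

lemma count_list_le_length: "count_list P Flat + count_list P Down \<le> length P"
proof (induction P)
  case (Cons s P)
  then show ?case by (cases s) auto
qed simp

lemma rise_ge: "- int (path_size P) \<le> rise P"
  using count_list_le_length[of P] by (simp add: rise_eq path_size_def)

lemma rise_size_paths_eq_empty: "r < - int n \<Longrightarrow> rise_size_paths r n = {}"
  by (auto simp: rise_size_paths_def dest!: order_le_less_trans[OF rise_ge])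

lemma finite_rise_size_paths: "finite (rise_size_paths r n)"
proof (rule finite_subset)
  \<comment> \<open>By \<open>rise_eq\<close> the length is the rise plus the flatsteps plus twice
    the downsteps, hence at most r + 2 n.\<close>
  show "rise_size_paths r n \<subseteq> {P. set P \<subseteq> {Up, Down, Flat} \<and> length P \<le> nat (r + 2 * int n)}"
  proof
    fix P assume "P \<in> rise_size_paths r n"
    then have "length P \<le> nat (r + 2 * int n)"
      unfolding rise_size_paths_def using rise_eq[of P] by (auto simp: path_size_def)
    moreover have "set P \<subseteq> {Up, Down, Flat}"
      using step.exhaust by blast
    ultimately show "P \<in> {P. set P \<subseteq> {Up, Down, Flat} \<and> length P \<le> nat (r + 2 * int n)}" by blast
  qed
  show "finite {P. set P \<subseteq> {Up, Down, Flat} \<and> length P \<le> nat (r + 2 * int n)}"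
    by (rule finite_lists_length_le) simp
qed

lemma path_eq_replicate_Up: "path_size P = 0 \<Longrightarrow> P = replicate (length P) Up"
proof (induction P)
  case (Cons s P)
  then show ?case by (cases s) auto
qed simp

section \<open>Splitting a path at its first step other than an upstep\<close>

lemma first_nonup_cases:
  obtains "P = replicate (length P) Up"
  | a s Q where "P = replicate a Up @ s # Q" "s \<noteq> Up"
proof (induction P arbitrary: thesis)
  case (Cons t P)
  show ?case
  proof (cases "t = Up")
    case True
    show ?thesis
    proof (rule Cons.IH)
      assume "P = replicate (length P) Up"
      then show thesis using Cons.prems(1) True by simp
    next
      fix a s Q assume "P = replicate a Up @ s # Q" "s \<noteq> Up"
      then show thesis using Cons.prems(2)[of "Suc a" s Q] True by simp
    qed
  next
    case False
    then show ?thesis using Cons.prems(2)[of 0 t P] by simp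
  qed
qed simp

lemma replicate_Up_append_inject:
  assumes "replicate a Up @ s # Q = replicate b Up @ t # R" "s \<noteq> Up" "t \<noteq> Up"
  shows "a = b \<and> s = t \<and> Q = R"
  using assms
proof (induction a arbitrary: b)
  case 0
  then show ?case by (cases b) auto
next
  case (Suc a)
  then show ?case by (cases b) auto
qed

text \<open>The map (a, s, Q) \<mapsto> U^a s Q is a bijection: positive size excludes paths of
  upsteps only, and s uses one unit of size. As Q has rise at least -n and s lowers the path by at
  most 1, a \<le> r + n + 1, which \<open>B\<close> dominates.\<close>

lemma sum_first_nonup:
  fixes f :: "path \<Rightarrow> 'a::comm_monoid_add"
  assumes B: "r + int (Suc n) \<le> int B"
  shows "(\<Sum>P\<in>rise_size_paths r (Suc n). f P) =
    (\<Sum>a\<le>B. \<Sum>s\<in>{Down, Flat}. \<Sum>Q\<in>rise_size_paths (r - int a - snd (step_vec s)) n.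
       f (replicate a Up @ s # Q))"
proof -
  let ?D = "SIGMA a:{..B}. SIGMA s:{Down, Flat}. rise_size_paths (r - int a - snd (step_vec s)) n"
  let ?h = "\<lambda>(a, s, Q). replicate a Up @ s # Q"
  have "bij_betw ?h ?D (rise_size_paths r (Suc n))"
  proof (rule bij_betwI')
    fix u v assume "u \<in> ?D" "v \<in> ?D"
    then show "?h u = ?h v \<longleftrightarrow> u = v"
      by (auto dest!: replicate_Up_append_inject)
  next
    fix u assume "u \<in> ?D"
    then show "?h u \<in> rise_size_paths r (Suc n)"
      by (auto simp: rise_size_paths_def)
  next
    fix P assume P: "P \<in> rise_size_paths r (Suc n)"
    show "\<exists>u\<in>?D. P = ?h u"
    proof (cases P rule: first_nonup_cases)
      case 1
      then have "path_size P = 0" by (metis path_size_replicate(1))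
      then show ?thesis using P by (simp add: rise_size_paths_def)
    next
      case (2 a s Q)
      have "s \<in> {Down, Flat}" using 2 by (cases s) auto
      moreover from this have "Q \<in> rise_size_paths (r - int a - snd (step_vec s)) n"
        using P 2 by (auto simp: rise_size_paths_def)
      moreover from calculation have "a \<le> B"
        using rise_ge[of Q] B by (auto simp: rise_size_paths_def)
      ultimately have "(a, s, Q) \<in> ?D" by blast
      then show ?thesis using 2 by (intro bexI[of _ "(a, s, Q)"]) auto
    qed
  qed
  then have "(\<Sum>P\<in>rise_size_paths r (Suc n). f P) = (\<Sum>u\<in>?D. f (?h u))"
    by (rule sum.reindex_bij_betw[symmetric])
  also have "\<dots> = (\<Sum>(a, s, Q)\<in>?D. f (replicate a Up @ s # Q))"
    by (simp add: case_prod_unfold)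
  also have "\<dots> = (\<Sum>a\<le>B. \<Sum>(s, Q)\<in>(SIGMA s:{Down, Flat}. rise_size_paths (r - int a - snd (step_vec s)) n).
       f (replicate a Up @ s # Q))"
    by (subst sum.Sigma) (auto intro!: finite_SigmaI finite_rise_size_paths)
  also have "\<dots> = (\<Sum>a\<le>B. \<Sum>s\<in>{Down, Flat}. \<Sum>Q\<in>rise_size_paths (r - int a - snd (step_vec s)) n.
       f (replicate a Up @ s # Q))"
    by (intro sum.cong refl, subst sum.Sigma) (auto intro!: finite_rise_size_paths)
  finally show ?thesis .
qed

text \<open>Deleting the b leading downsteps raises the rise by b and lowers the size by b. If b >
  n, no path in the range starts with b downsteps.\<close>

lemma sum_leading_Downs:
  fixes f :: "path \<Rightarrow> 'a::comm_monoid_add"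
  shows "(\<Sum>Q\<in>rise_size_paths r n. if \<exists>R. Q = replicate b Down @ R then f Q else 0) =
    (if b \<le> n then \<Sum>R\<in>rise_size_paths (r + int b) (n - b). f (replicate b Down @ R) else 0)"
proof (cases "b \<le> n")
  case True
  have "(\<Sum>Q\<in>rise_size_paths r n. if \<exists>R. Q = replicate b Down @ R then f Q else 0) =
      sum f {Q \<in> rise_size_paths r n. \<exists>R. Q = replicate b Down @ R}"
    by (simp add: sum.inter_filter finite_rise_size_paths)
  also have "{Q \<in> rise_size_paths r n. \<exists>R. Q = replicate b Down @ R} =
      (\<lambda>R. replicate b Down @ R) ` rise_size_paths (r + int b) (n - b)"
    using True by (auto simp: rise_size_paths_def)
  also have "sum f \<dots> = (\<Sum>R\<in>rise_size_paths (r + int b) (n - b). f (replicate b Down @ R))"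
    by (subst sum.reindex) (auto simp: inj_on_def)
  finally show ?thesis using True by simp
next
  case False
  then show ?thesis by (auto simp: rise_size_paths_def intro!: sum.neutral)
qed

section \<open>Pyramid ascents described step by step\<close>

lemma subpath_eq_iff:
  assumes "i \<le> j" "j \<le> length P"
  shows "subpath P i j = w \<longleftrightarrow> length w = j - i \<and> (\<forall>k<length w. P ! (i + k) = w ! k)"
  using assms by (auto simp: subpath_def list_eq_iff_nth_eq)

lemma subpath_Ups_iff:
  assumes "i \<le> j" "j \<le> length P"
  shows "(\<exists>k\<ge>1. subpath P i j = replicate k Up) \<longleftrightarrow> i < j \<and> (\<forall>k. i \<le> k \<and> k < j \<longrightarrow> P ! k = Up)"
proof
  assume "i < j \<and> (\<forall>k. i \<le> k \<and> k < j \<longrightarrow> P ! k = Up)"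
  then show "\<exists>k\<ge>1. subpath P i j = replicate k Up"
    using assms by (intro exI[of _ "j - i"]) (auto simp: subpath_eq_iff)
next
  assume "\<exists>k\<ge>1. subpath P i j = replicate k Up"
  then have *: "i < j" "\<And>k. k < j - i \<Longrightarrow> P ! (i + k) = Up"
    using assms by (auto simp: subpath_eq_iff)
  show "i < j \<and> (\<forall>k. i \<le> k \<and> k < j \<longrightarrow> P ! k = Up)"
    using * by (metis add_diff_inverse_nat diff_less_mono not_less)
qed

lemma subpath_pyramid_iff:
  assumes "i \<le> j" "j \<le> length P"
  shows "(\<exists>k\<ge>1. subpath P i j = replicate k Up @ replicate k Down) \<longleftrightarrow>
    (\<exists>k\<ge>1. j = i + 2 * k \<and> (\<forall>l. i \<le> l \<and> l < i + k \<longrightarrow> P ! l = Up) \<and>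
      (\<forall>l. i + k \<le> l \<and> l < j \<longrightarrow> P ! l = Down))"
proof (intro ex_cong1 conj_cong refl)
  fix k :: nat
  show "subpath P i j = replicate k Up @ replicate k Down \<longleftrightarrow>
    j = i + 2 * k \<and> (\<forall>l. i \<le> l \<and> l < i + k \<longrightarrow> P ! l = Up) \<and> (\<forall>l. i + k \<le> l \<and> l < j \<longrightarrow> P ! l = Down)"
    (is "?L \<longleftrightarrow> ?R")
  proof
    assume ?L
    then have *: "j = i + 2 * k"
      "\<And>l. l < 2 * k \<Longrightarrow> P ! (i + l) = (if l < k then Up else Down)"
      using assms by (auto simp: subpath_eq_iff nth_append)
    have "P ! l = (if l < i + k then Up else Down)" if "i \<le> l" "l < j" for l
      using *(2)[of "l - i"] *(1) that by (auto split: if_splits)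
    then show ?R using * by auto
  next
    assume ?R
    then show ?L using assms by (auto simp: subpath_eq_iff nth_append)
  qed
qed

definition pyramid_at :: "path \<Rightarrow> nat \<Rightarrow> nat \<Rightarrow> bool" where
  "pyramid_at P i j \<longleftrightarrow> i < j \<and> j + (j - i) \<le> length P \<and>
     (\<forall>k. i \<le> k \<and> k < j \<longrightarrow> P ! k = Up) \<and> (\<forall>k. j \<le> k \<and> k < j + (j - i) \<longrightarrow> P ! k = Down) \<and>
     (i = 0 \<or> P ! (i - 1) \<noteq> Up)"

text \<open>Both maximality conditions reduce to the step before \<open>i\<close>. The downstep at
  \<open>j\<close> stops the ascent on the right, and a pyramid containing this one has the same
  peak, so it can only be larger by starting earlier. Further downsteps after the pyramid do no
  harm.\<close>

lemma pyramid_ascent_iff: "pyramid_ascent P i j \<longleftrightarrow> pyramid_at P i j"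
proof
  assume "pyramid_ascent P i j"
  then have asc: "ascent P i j" and pyr: "pyramid P i (j + (j - i))"
    by (auto simp: pyramid_ascent_def)
  have j: "i \<le> j" "j \<le> length P"
    using asc by (auto simp: ascent_def maximal_subpath_def)
  have ups: "i < j" "\<And>k. i \<le> k \<Longrightarrow> k < j \<Longrightarrow> P ! k = Up"
    using asc subpath_Ups_iff[OF j] by (auto simp: ascent_def maximal_subpath_def)
  have len: "j + (j - i) \<le> length P"
    using pyr by (auto simp: pyramid_def maximal_subpath_def)
  have "\<exists>k\<ge>1. subpath P i (j + (j - i)) = replicate k Up @ replicate k Down"
    using pyr by (auto simp: pyramid_def maximal_subpath_def)
  then obtain k where k: "j + (j - i) = i + 2 * k" "\<And>l. i + k \<le> l \<Longrightarrow> l < j + (j - i) \<Longrightarrow> P ! l = Down"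
    using j len by (subst (asm) subpath_pyramid_iff) auto
  have "j = i + k" using k(1) j by linarith
  have "P ! (i - 1) \<noteq> Up" if "i \<noteq> 0"
  proof
    assume "P ! (i - 1) = Up"
    then have "P ! k = Up" if "i - 1 \<le> k" "k < j" for k
      using ups(2)[of k] that by (cases "k = i - 1") auto
    then have "\<exists>k\<ge>1. subpath P (i - 1) j = replicate k Up"
      using j ups(1) by (subst subpath_Ups_iff) auto
    then have "i - 1 = i"
      using asc j unfolding ascent_def maximal_subpath_def by (meson diff_le_self order_refl)
    then show False using that by simp
  qed
  then show "pyramid_at P i j"
    using ups len k(2) \<open>j = i + k\<close> by (auto simp: pyramid_at_def)
next
  assume "pyramid_at P i j"
  then have ij: "i < j" and len: "j + (j - i) \<le> length P"
    and ups: "\<And>k. i \<le> k \<Longrightarrow> k < j \<Longrightarrow> P ! k = Up"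
    and downs: "\<And>k. j \<le> k \<Longrightarrow> k < j + (j - i) \<Longrightarrow> P ! k = Down"
    and left: "i = 0 \<or> P ! (i - 1) \<noteq> Up"
    by (auto simp: pyramid_at_def)
  have Pj: "P ! j = Down" using downs[of j] ij by simp
  have start: "i' = i" if "i' \<le> i" "\<And>k. i' \<le> k \<Longrightarrow> k < i \<Longrightarrow> P ! k = Up" for i'
  proof (rule ccontr)
    assume "i' \<noteq> i"
    then have "i \<noteq> 0" "P ! (i - 1) = Up" using that by auto
    then show False using left by blast
  qed
  have "ascent P i j"
    unfolding ascent_def maximal_subpath_def
  proof (intro conjI allI impI; (elim conjE)?)
    show "\<exists>k\<ge>1. subpath P i j = replicate k Up"
      using ij len ups by (subst subpath_Ups_iff) auto
    fix i' j' assume A: "i' \<le> i" "j \<le> j'" "j' \<le> length P" "\<exists>k\<ge>1. subpath P i' j' = replicate k Up"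
    then have U: "\<And>k. i' \<le> k \<Longrightarrow> k < j' \<Longrightarrow> P ! k = Up"
      using ij by (subst (asm) subpath_Ups_iff) auto
    show "i' = i" using start U A ij by simp
    show "j' = j" using U[of j] Pj A ij by (cases "j' = j") auto
  qed (use ij len in auto)
  moreover have "pyramid P i (j + (j - i))"
    unfolding pyramid_def maximal_subpath_def
  proof (intro conjI allI impI; (elim conjE)?)
    show "\<exists>k\<ge>1. subpath P i (j + (j - i)) = replicate k Up @ replicate k Down"
      using ij len ups downs by (subst subpath_pyramid_iff) (auto intro!: exI[of _ "j - i"])
    fix i' j' assume A: "i' \<le> i" "j + (j - i) \<le> j'" "j' \<le> length P"
      "\<exists>k\<ge>1. subpath P i' j' = replicate k Up @ replicate k Down"
    then obtain k where k: "k \<ge> 1" "j' = i' + 2 * k" "\<And>l. i' \<le> l \<Longrightarrow> l < i' + k \<Longrightarrow> P ! l = Up"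
      "\<And>l. i' + k \<le> l \<Longrightarrow> l < j' \<Longrightarrow> P ! l = Down"
      using ij by (subst (asm) subpath_pyramid_iff) auto
    \<comment> \<open>Step \<open>j - 1\<close> is an upstep and step \<open>j\<close> a downstep,
      so the larger pyramid also has its peak at \<open>j\<close>. Its first half then consists of
      upsteps from \<open>i'\<close>, which \<open>start\<close> excludes unless
      \<open>i' = i\<close>; equal halves fix \<open>j'\<close>.\<close>
    have "j - 1 < i' + k"
    proof (rule ccontr)
      assume "\<not> j - 1 < i' + k"
      then have "P ! (j - 1) = Down" using A ij by (intro k(4)) linarith+
      moreover have "P ! (j - 1) = Up" using ij by (intro ups) linarith+
      ultimately show False by simp
    qed
    moreover have "i' + k \<le> j"
      using k(3)[of j] Pj A ij by (cases "i' + k \<le> j") auto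
    ultimately have peak: "i' + k = j" by linarith
    show "i' = i" using start A k(3) peak ij by simp
    then show "j' = j + (j - i)" using k(2) peak by simp
  qed (use ij len in auto)
  ultimately show "pyramid_ascent P i j" by (simp add: pyramid_ascent_def)
qed

lemma pa_eq: "pa P = card {(i, j). pyramid_at P i j}"
  by (simp add: pa_def pyramid_ascent_iff)

section \<open>Effect on \<open>pa\<close> of removing the first ascent and the step after
  it\<close>

lemma pa_replicate_Up: "pa (replicate a Up) = 0"
proof -
  have "\<not> pyramid_at (replicate a Up) i j" for i j
  proof
    assume *: "pyramid_at (replicate a Up) i j"
    then have "replicate a Up ! j = Down" "j < a" by (auto simp: pyramid_at_def)
    then show False by simp
  qed
  then show ?thesis by (simp add: pa_eq)
qed

lemma finite_pyramid_at: "finite {(i, j). pyramid_at P i j}"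
  by (rule finite_subset[of _ "{..length P} \<times> {..length P}"]) (auto simp: pyramid_at_def)

lemma nth_replicate_append_shift: "(replicate a u @ s # Q) ! (Suc (a + k)) = Q ! k"
  by (simp add: nth_append)

text \<open>The delicate case is \<open>i = 0\<close>: a pyramid at the very start of
  \<open>Q\<close> stays left-maximal in the longer path because the step \<open>s\<close> before it
  is not an upstep.\<close>

lemma pyramid_at_shift:
  assumes "s \<noteq> Up"
  shows "pyramid_at (replicate a Up @ s # Q) (Suc (a + i)) (Suc (a + j)) \<longleftrightarrow> pyramid_at Q i j"
proof -
  let ?P = "replicate a Up @ s # Q"
  have shift: "(\<forall>k. Suc (a + u) \<le> k \<and> k < Suc (a + v) \<longrightarrow> ?P ! k = t) \<longleftrightarrow>
      (\<forall>k. u \<le> k \<and> k < v \<longrightarrow> Q ! k = t)" for u v t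
  proof (intro iffI allI impI)
    fix k assume "\<forall>k. Suc (a + u) \<le> k \<and> k < Suc (a + v) \<longrightarrow> ?P ! k = t" "u \<le> k \<and> k < v"
    then show "Q ! k = t"
      using nth_replicate_append_shift[of a Up s Q k] by (metis Suc_le_mono add_le_cancel_left add_less_cancel_left not_less_eq not_less)
  next
    fix k assume *: "\<forall>k. u \<le> k \<and> k < v \<longrightarrow> Q ! k = t" "Suc (a + u) \<le> k \<and> k < Suc (a + v)"
    then obtain l where "k = Suc (a + l)" by (metis add_Suc add_leD1 le_Suc_ex)
    then show "?P ! k = t" using * nth_replicate_append_shift[of a Up s Q l] by simp
  qed
  have top: "Suc (a + j) + (Suc (a + j) - Suc (a + i)) = Suc (a + (j + (j - i)))" by simp
  have left: "(?P ! (Suc (a + i) - 1) \<noteq> Up) = (i = 0 \<or> Q ! (i - 1) \<noteq> Up)"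
    using assms by (cases i) (simp_all add: nth_append)
  show ?thesis
    unfolding pyramid_at_def top shift left by auto
qed

text \<open>A start strictly between 0 and a, or equal to a > 0, is preceded by an upstep, so only 0
  remains. The ascent from there ends at \<open>s\<close>, which must be the first of the a
  downsteps; \<open>Q\<close> supplies the other a - 1.\<close>

lemma pyramid_at_leading:
  assumes "s \<noteq> Up" "i \<le> a"
  shows "pyramid_at (replicate a Up @ s # Q) i j \<longleftrightarrow>
    i = 0 \<and> j = a \<and> 0 < a \<and> s = Down \<and> (\<exists>R. Q = replicate (a - 1) Down @ R)"
proof
  let ?P = "replicate a Up @ s # Q"
  assume p: "pyramid_at ?P i j"
  then have ij: "i < j" and len: "j + (j - i) \<le> length ?P"
    and ups: "\<And>k. i \<le> k \<Longrightarrow> k < j \<Longrightarrow> ?P ! k = Up"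
    and downs: "\<And>k. j \<le> k \<Longrightarrow> k < j + (j - i) \<Longrightarrow> ?P ! k = Down"
    and left: "i = 0 \<or> ?P ! (i - 1) \<noteq> Up"
    by (auto simp: pyramid_at_def)
  have i: "i = 0" using left assms(2) by (cases i) (auto simp: nth_append)
  have "j \<le> a" using ups[of a] assms ij by (cases "j \<le> a") (auto simp: nth_append)
  moreover have "a \<le> j"
  proof (rule ccontr)
    assume "\<not> a \<le> j"
    then have "?P ! j = Up" by (simp add: nth_append)
    moreover have "?P ! j = Down" using ij by (intro downs) linarith+
    ultimately show False by simp
  qed
  ultimately have j: "j = a" by simp
  have s: "s = Down" using downs[of a] ij i j by (auto simp: nth_append)
  have "Q ! k = Down" if "k < a - 1" for k
    using downs[of "Suc (a + k)"] nth_replicate_append_shift[of a Up s Q k] that i j by auto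
  moreover have "a - 1 \<le> length Q" using len i j by simp
  ultimately have "take (a - 1) Q = replicate (a - 1) Down"
    by (auto simp: list_eq_iff_nth_eq)
  then have "Q = replicate (a - 1) Down @ drop (a - 1) Q" by (metis append_take_drop_id)
  then show "i = 0 \<and> j = a \<and> 0 < a \<and> s = Down \<and> (\<exists>R. Q = replicate (a - 1) Down @ R)"
    using i j s ij by blast
next
  assume "i = 0 \<and> j = a \<and> 0 < a \<and> s = Down \<and> (\<exists>R. Q = replicate (a - 1) Down @ R)"
  then obtain R where R: "i = 0" "j = a" "0 < a" "s # Q = replicate a Down @ R"
    by (cases a) auto
  then show "pyramid_at (replicate a Up @ s # Q) i j"
    unfolding R(4) by (auto simp: pyramid_at_def nth_append)
qed

text \<open>Pyramid ascents are sorted by their start: those beyond index a are the ones of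
  \<open>Q\<close> shifted by a + 1, and at most one starts earlier, namely at 0.\<close>

lemma pa_first_nonup:
  assumes "s \<noteq> Up"
  shows "pa (replicate a Up @ s # Q) =
    pa Q + (if 0 < a \<and> s = Down \<and> (\<exists>R. Q = replicate (a - 1) Down @ R) then 1 else 0)"
proof -
  let ?P = "replicate a Up @ s # Q" and ?sh = "\<lambda>(i, j). (Suc (a + i), Suc (a + j))"
  let ?c = "0 < a \<and> s = Down \<and> (\<exists>R. Q = replicate (a - 1) Down @ R)"
  have split: "{(i, j). pyramid_at ?P i j} =
      ?sh ` {(i, j). pyramid_at Q i j} \<union> (if ?c then {(0, a)} else {})" (is "?A = ?B \<union> ?C")
  proof (intro equalityI subsetI)
    fix u assume "u \<in> ?A"
    then obtain i j where u: "u = (i, j)" "pyramid_at ?P i j" by auto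
    show "u \<in> ?B \<union> ?C"
    proof (cases "i \<le> a")
      case True
      then show ?thesis using u pyramid_at_leading[OF assms] by auto
    next
      case False
      have "i < j" using u by (simp add: pyramid_at_def)
      with False obtain i' j' where "i = Suc (a + i')" "j = Suc (a + j')"
        by (metis add_Suc less_imp_Suc_add less_trans not_le)
      then show ?thesis using u pyramid_at_shift[OF assms] by auto
    qed
  next
    fix u assume "u \<in> ?B \<union> ?C"
    then show "u \<in> ?A"
      using pyramid_at_shift[OF assms] pyramid_at_leading[OF assms, of 0]
      by (auto split: if_splits)
  qed
  have "card ?A = card ?B + card ?C"
    unfolding split by (rule card_Un_disjoint) (auto simp: finite_pyramid_at)
  also have "card ?B = pa Q"
    unfolding pa_eq by (rule card_image) (auto simp: inj_on_def)
  finally show ?thesis by (simp add: pa_eq)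
qed

lemma pa_replicate_Down_append: "pa (replicate b Down @ R) = pa R"
  using pa_first_nonup[of Down 0] by (induction b) auto

section \<open>The recursion for the weighted sums and its solution\<close>

definition pyramid_invariant :: "(path \<Rightarrow> 'a) \<Rightarrow> bool" where
  "pyramid_invariant w \<longleftrightarrow> (\<forall>A k B. w (A @ replicate k Up @ replicate k Down @ B) = w (A @ B))"

text \<open>This is the coefficient of x^n in F(w), restricted to rise \<open>r\<close>. Letting
  \<open>y\<close> be any ring element covers both the indeterminate and the value 1.\<close>

definition pa_sum :: "'a::comm_ring_1 \<Rightarrow> int \<Rightarrow> (path \<Rightarrow> 'a) \<Rightarrow> nat \<Rightarrow> 'a" where
  "pa_sum y r w n = (\<Sum>P\<in>rise_size_paths r n. y ^ pa P * w P)"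

text \<open>Invariance allows an arbitrary prefix before the inserted pyramid, so it passes to the
  weights w(U^a s Q) that the recursion produces.\<close>

lemma pyramid_invariant_prefix:
  "pyramid_invariant w \<Longrightarrow> pyramid_invariant (\<lambda>Q. w (A @ Q))"
  unfolding pyramid_invariant_def by (metis append_assoc)

text \<open>The bound on \<open>a\<close> loses nothing: a path of size \<open>n\<close> has rise at least \<open>- n\<close>, so larger \<open>a\<close>
  contribute empty sums.\<close>

definition first_nonup_sum :: "'a::comm_ring_1 \<Rightarrow> int \<Rightarrow> (path \<Rightarrow> 'a) \<Rightarrow> nat \<Rightarrow> 'a" where
  "first_nonup_sum y r w n = (\<Sum>a\<le>Suc (nat \<bar>r\<bar> + n). \<Sum>s\<in>{Down, Flat}.
     pa_sum y (r - int a - snd (step_vec s)) (\<lambda>Q. w (replicate a Up @ s # Q)) n)"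

text \<open>In the pyramid case with a = b + 1, deleting the pyramid keeps rise and weight and
  leaves size n - b. Each b \<le> n thus contributes one full sum over the remaining paths
  \<open>R\<close>.\<close>

lemma pa_sum_Suc:
  assumes inv: "pyramid_invariant w"
  shows "pa_sum y r w (Suc n) = first_nonup_sum y r w n + (y - 1) * (\<Sum>b\<le>n. pa_sum y r w (n - b))"
proof -
  define B where "B = nat \<bar>r\<bar> + n"
  \<comment> \<open>The excess over y^(pa Q) when the first ascent is a pyramid ascent: y^(p + 1) =
    y^p + (y - 1) y^p.\<close>
  define t where "t = (\<lambda>a s Q. if 0 < a \<and> s = Down \<and> (\<exists>R. Q = replicate (a - 1) Down @ R)
     then (y - 1) * (y ^ pa Q * w (replicate a Up @ s # Q)) else 0)"
  have ins: "w (replicate (Suc b) Up @ Down # replicate b Down @ R) = w R" for b R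
  proof -
    have "w ([] @ replicate (Suc b) Up @ replicate (Suc b) Down @ R) = w ([] @ R)"
      using inv unfolding pyramid_invariant_def by blast
    then show ?thesis by simp
  qed
  have "pa_sum y r w (Suc n) =
      (\<Sum>a\<le>Suc B. \<Sum>s\<in>{Down, Flat}. \<Sum>Q\<in>rise_size_paths (r - int a - snd (step_vec s)) n.
        y ^ pa (replicate a Up @ s # Q) * w (replicate a Up @ s # Q))"
    unfolding pa_sum_def by (rule sum_first_nonup) (simp add: B_def)
  also have "\<dots> = (\<Sum>a\<le>Suc B. \<Sum>s\<in>{Down, Flat}. \<Sum>Q\<in>rise_size_paths (r - int a - snd (step_vec s)) n.
        y ^ pa Q * w (replicate a Up @ s # Q) + t a s Q)"
    by (intro sum.cong refl, subst pa_first_nonup) (auto simp: t_def algebra_simps)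
  also have "\<dots> = first_nonup_sum y r w n +
      (\<Sum>a\<le>Suc B. \<Sum>s\<in>{Down, Flat}. \<Sum>Q\<in>rise_size_paths (r - int a - snd (step_vec s)) n. t a s Q)"
    by (simp only: first_nonup_sum_def pa_sum_def B_def sum.distrib)
  also have "(\<Sum>a\<le>Suc B. \<Sum>s\<in>{Down, Flat}. \<Sum>Q\<in>rise_size_paths (r - int a - snd (step_vec s)) n. t a s Q)
      = (\<Sum>a\<le>Suc B. \<Sum>Q\<in>rise_size_paths (r - int a + 1) n. t a Down Q)"
    by (simp add: t_def)
  \<comment> \<open>Reindexing by a = b + 1; the term a = 0 vanishes because \<open>t\<close>
    requires a nonempty ascent.\<close>
  also have "\<dots> = (\<Sum>b\<le>B. \<Sum>Q\<in>rise_size_paths (r - int b) n. t (Suc b) Down Q)"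
    by (subst sum.atMost_Suc_shift) (simp add: t_def)
  also have "\<dots> = (\<Sum>b\<le>B. if b \<le> n then (y - 1) * pa_sum y r w (n - b) else 0)"
  proof (intro sum.cong refl)
    fix b
    have "(\<Sum>Q\<in>rise_size_paths (r - int b) n. t (Suc b) Down Q) =
        (\<Sum>Q\<in>rise_size_paths (r - int b) n. if \<exists>R. Q = replicate b Down @ R
          then (y - 1) * (y ^ pa Q * w (replicate (Suc b) Up @ Down # Q)) else 0)"
      by (simp add: t_def)
    also have "\<dots> = (if b \<le> n then (y - 1) * pa_sum y r w (n - b) else 0)"
      unfolding sum_leading_Downs ins pa_replicate_Down_append pa_sum_def
      by (simp add: sum_distrib_left)
    finally show "(\<Sum>Q\<in>rise_size_paths (r - int b) n. t (Suc b) Down Q) =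
      (if b \<le> n then (y - 1) * pa_sum y r w (n - b) else 0)" .
  qed
  also have "\<dots> = (\<Sum>b\<le>n. (y - 1) * pa_sum y r w (n - b))"
    by (rule sum.mono_neutral_cong_right) (auto simp: B_def)
  finally show ?thesis by (simp add: sum_distrib_left)
qed

text \<open>Paths of size 0 consist of upsteps only and have no pyramid.\<close>

lemma pa_sum_0: "pa_sum y r w 0 = pa_sum 1 r w 0"
proof -
  have "pa P = 0" if "path_size P = 0" for P
    using path_eq_replicate_Up[OF that] pa_replicate_Up by metis
  then show ?thesis
    by (auto simp: pa_sum_def rise_size_paths_def)
qed

text \<open>A bound common to several sizes makes it possible to interchange the sum over a with a
  sum over sizes.\<close>

lemma first_nonup_sum_bound:
  assumes "Suc (nat \<bar>r\<bar> + n) \<le> B"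
  shows "first_nonup_sum y r w n = (\<Sum>a\<le>B. \<Sum>s\<in>{Down, Flat}.
     pa_sum y (r - int a - snd (step_vec s)) (\<lambda>Q. w (replicate a Up @ s # Q)) n)"
  unfolding first_nonup_sum_def
proof (rule sum.mono_neutral_left)
  have "rise_size_paths (r - int a - snd (step_vec s)) n = {}"
    if "s \<in> {Down, Flat}" "\<not> a \<le> Suc (nat \<bar>r\<bar> + n)" for a s
    using that by (intro rise_size_paths_eq_empty) auto
  then show "\<forall>a\<in>{..B} - {..Suc (nat \<bar>r\<bar> + n)}. (\<Sum>s\<in>{Down, Flat}.
      pa_sum y (r - int a - snd (step_vec s)) (\<lambda>Q. w (replicate a Up @ s # Q)) n) = 0"
    by (intro ballI sum.neutral) (simp add: pa_sum_def)
qed (use assms in auto)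

lemma pa_sum_1_Suc:
  "pyramid_invariant w \<Longrightarrow> pa_sum 1 r w (Suc n) = first_nonup_sum 1 r w n"
  by (simp add: pa_sum_Suc)

text \<open>Here \<open>C\<close> stands for (1 - x)/(1 - xy) and \<open>V\<close> for 1/(1 - xy),
  given by equations since the coefficients need not form a field. With K the series on the right
  and E = 1/(1 - x), \<open>pa_sum_Suc\<close> says F = K + (y - 1) x E F. Multiplying by 1 - x
  gives (1 - xy) F = (1 - x) K, and \<open>V\<close> cancels the factor 1 - xy.\<close>

lemma pa_series_eq:
  fixes C :: "'a::comm_ring_1 fps"
  assumes inv: "pyramid_invariant w"
    and C: "(1 - fps_X * fps_const y) * C = 1 - fps_X"
    and unit: "(1 - fps_X * fps_const y) * V = 1"
  shows "Abs_fps (pa_sum y r w) =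
    C * Abs_fps (case_nat (pa_sum 1 r w 0) (first_nonup_sum y r w))" (is "?F = C * ?K")
proof -
  define E :: "'a fps" where "E = Abs_fps (\<lambda>_. 1)"
  have E: "(1 - fps_X) * E = 1"
    by (rule fps_ext) (simp add: E_def algebra_simps fps_X_mult_nth)
  define F where "F = ?F"
  define K where "K = ?K"
  have "F = K + fps_const (y - 1) * (fps_X * (E * F))"
  proof (rule fps_ext)
    fix n show "F $ n = (K + fps_const (y - 1) * (fps_X * (E * F))) $ n"
    proof (cases n)
      case 0
      then show ?thesis using pa_sum_0[of y r w] by (simp add: F_def K_def)
    next
      case (Suc k)
      have "(E * F) $ k = (\<Sum>b\<le>k. pa_sum y r w (k - b))"
        unfolding fps_mult_nth by (simp add: E_def F_def atLeast0AtMost)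
      then show ?thesis
        using Suc by (simp add: F_def K_def pa_sum_Suc[OF inv] del: fps_const_sub)
    qed
  qed
  then have "(1 - fps_X) * F = (1 - fps_X) * (K + fps_const (y - 1) * (fps_X * (E * F)))"
    by (rule arg_cong)
  also have "\<dots> = (1 - fps_X) * K + (fps_const y - 1) * fps_X * (((1 - fps_X) * E) * F)"
    by (simp add: algebra_simps flip: fps_const_sub)
  finally have "(1 - fps_X * fps_const y) * F = (1 - fps_X) * K"
    unfolding E by (simp add: algebra_simps)
  also have "\<dots> = (1 - fps_X * fps_const y) * (C * K)"
    unfolding C[symmetric] by (simp only: mult.assoc)
  finally have "((1 - fps_X * fps_const y) * V) * F = ((1 - fps_X * fps_const y) * V) * (C * K)"
    by (simp only: mult.assoc mult.left_commute[of _ V])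
  then show ?thesis
    unfolding unit F_def K_def by simp
qed

text \<open>Strong induction on the size, with rise and weight arbitrary because the recursion
  changes both. In F = C K the coefficients of K involve only smaller sizes; inserting their
  expansions turns K into the sum of (xC)^j times the sums at y = 1.\<close>

lemma pa_sum_expand:
  fixes C :: "'a::comm_ring_1 fps"
  assumes "pyramid_invariant w"
    and C: "(1 - fps_X * fps_const y) * C = 1 - fps_X"
    and unit: "(1 - fps_X * fps_const y) * V = 1"
  shows "pa_sum y r w n = (\<Sum>j\<le>n. (C * (fps_X * C) ^ j) $ n * pa_sum 1 r w j)"
  using assms(1)
proof (induction n arbitrary: r w rule: less_induct)
  case (less n)
  note inv = less.prems
  define c where "c = (\<lambda>j i. (C * (fps_X * C) ^ j) $ i)"
  \<comment> \<open>The factor x^j kills the low coefficients, so all sums over j may share the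
    range below n.\<close>
  have c0: "c j i = 0" if "i < j" for i j
  proof -
    have "C * (fps_X * C) ^ j = fps_X ^ j * (C * C ^ j)"
      by (simp add: power_mult_distrib algebra_simps)
    then show ?thesis using that by (simp add: c_def fps_X_power_mult_nth)
  qed
  have K: "first_nonup_sum y r w k = (\<Sum>j<n. c j k * first_nonup_sum 1 r w j)" if "k < n" for k
  proof -
    define f where "f = (\<lambda>a s. pa_sum 1 (r - int a - snd (step_vec s)) (\<lambda>Q. w (replicate a Up @ s # Q)))"
    \<comment> \<open>One bound on a that serves every size up to n.\<close>
    define B where "B = Suc (nat \<bar>r\<bar> + n)"
    have IH: "pa_sum y (r - int a - snd (step_vec s)) (\<lambda>Q. w (replicate a Up @ s # Q)) k =
        (\<Sum>j<n. c j k * f a s j)" for a s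
    proof -
      have "pyramid_invariant (\<lambda>Q. w (replicate a Up @ s # Q))"
        using pyramid_invariant_prefix[OF inv, of "replicate a Up @ [s]"] by simp
      then have "pa_sum y (r - int a - snd (step_vec s)) (\<lambda>Q. w (replicate a Up @ s # Q)) k =
          (\<Sum>j\<le>k. c j k * f a s j)"
        unfolding c_def f_def by (rule less.IH[OF that])
      also have "\<dots> = (\<Sum>j<n. c j k * f a s j)"
        using that by (intro sum.mono_neutral_left) (auto simp: c0)
      finally show ?thesis .
    qed
    have "first_nonup_sum y r w k = (\<Sum>a\<le>B. \<Sum>s\<in>{Down, Flat}. \<Sum>j<n. c j k * f a s j)"
      using that by (subst first_nonup_sum_bound[of r k B]) (simp_all only: IH, simp add: B_def)
    also have "\<dots> = (\<Sum>j<n. \<Sum>a\<le>B. \<Sum>s\<in>{Down, Flat}. c j k * f a s j)"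
      by (simp only: sum.swap[of _ "{..<n}" "{Down, Flat}"] sum.swap[of _ "{..<n}" "{..B}"])
    also have "\<dots> = (\<Sum>j<n. c j k * first_nonup_sum 1 r w j)"
    proof (intro sum.cong refl)
      fix j assume "j \<in> {..<n}"
      then have "first_nonup_sum 1 r w j = (\<Sum>a\<le>B. \<Sum>s\<in>{Down, Flat}. f a s j)"
        unfolding f_def by (intro first_nonup_sum_bound) (simp add: B_def)
      then show "(\<Sum>a\<le>B. \<Sum>s\<in>{Down, Flat}. c j k * f a s j) = c j k * first_nonup_sum 1 r w j"
        by (simp only: sum_distrib_left)
    qed
    finally show ?thesis .
  qed
  define L where "L = Abs_fps (case_nat (pa_sum 1 r w 0) (first_nonup_sum y r w))"
  \<comment> \<open>The term j = 0 is the constant 1 and accounts for \<open>i = 0\<close> only. For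
    \<open>i = Suc k\<close>, one more factor xC moves \<open>c j k\<close> to exponent
    \<open>Suc j\<close>, where \<open>first_nonup_sum 1 r w j\<close> is the sum at y = 1 of size
    \<open>Suc j\<close>.\<close>
  have L: "L $ i = (\<Sum>j\<le>n. ((fps_X * C) ^ j) $ i * pa_sum 1 r w j)" if "i \<le> n" for i
  proof (cases i)
    case 0
    then show ?thesis by (simp add: L_def sum.atMost_shift)
  next
    case (Suc k)
    have "((fps_X * C) ^ Suc j) $ i = c j k" for j
      by (simp add: c_def Suc mult.assoc)
    then show ?thesis
      using K[of k] that Suc by (simp add: L_def sum.atMost_shift pa_sum_1_Suc[OF inv] del: power_Suc)
  qed
  have "pa_sum y r w n = (C * L) $ n"
    unfolding L_def using pa_series_eq[OF inv C unit, of r] by (metis fps_nth_Abs_fps)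
  also have "\<dots> = (\<Sum>i=0..n. \<Sum>j\<le>n. C $ i * ((fps_X * C) ^ j) $ (n - i) * pa_sum 1 r w j)"
    unfolding fps_mult_nth by (simp add: L sum_distrib_left mult.assoc)
  also have "\<dots> = (\<Sum>j\<le>n. \<Sum>i=0..n. C $ i * ((fps_X * C) ^ j) $ (n - i) * pa_sum 1 r w j)"
    by (rule sum.swap)
  also have "\<dots> = (\<Sum>j\<le>n. (C * (fps_X * C) ^ j) $ n * pa_sum 1 r w j)"
    by (simp only: fps_mult_nth sum_distrib_right)
  finally show ?case .
qed

text \<open>Composition with xC has the same expansion as \<open>pa_sum_expand\<close>. Since (xC)^j
  starts at x^j, the range j \<le> n can be used for all coefficients up to n, and the sums can be
  interchanged.\<close>

lemma mult_fps_compose_nth: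
  fixes C f :: "'a::comm_ring_1 fps"
  shows "(C * (f oo (fps_X * C))) $ n = (\<Sum>j\<le>n. (C * (fps_X * C) ^ j) $ n * f $ j)"
proof -
  have "(f oo (fps_X * C)) $ i = (\<Sum>j\<le>n. f $ j * ((fps_X * C) ^ j) $ i)" if "i \<le> n" for i
    unfolding fps_compose_nth using that
    by (intro sum.mono_neutral_left) (auto simp: power_mult_distrib fps_X_power_mult_nth)
  then have "(C * (f oo (fps_X * C))) $ n =
      (\<Sum>i=0..n. \<Sum>j\<le>n. C $ i * ((fps_X * C) ^ j) $ (n - i) * f $ j)"
    unfolding fps_mult_nth by (simp add: sum_distrib_left algebra_simps)
  also have "\<dots> = (\<Sum>j\<le>n. \<Sum>i=0..n. C $ i * ((fps_X * C) ^ j) $ (n - i) * f $ j)"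
    by (rule sum.swap)
  also have "\<dots> = (\<Sum>j\<le>n. (C * (fps_X * C) ^ j) $ n * f $ j)"
    by (simp only: fps_mult_nth sum_distrib_right)
  finally show ?thesis .
qed

section \<open>Inserting a pyramid preserves membership in \<open>paths m d\<close> and the flatstep
  weight\<close>

lemma level_length: "level m P (length P) = int m + rise P"
  by (simp add: level_def rise_def)

lemma level_snoc: "k \<le> length P \<Longrightarrow> level m (P @ [s]) k = level m P k"
  by (simp add: level_def)

lemma levels_snoc:
  "level m (P @ [s]) ` {0..length (P @ [s])} =
    insert (int m + rise (P @ [s])) (level m P ` {0..length P})"
proof -
  have "{0..length (P @ [s])} = insert (length (P @ [s])) {0..length P}" by auto
  then show ?thesis
    by (simp only: image_insert level_length) (simp add: level_snoc cong: image_cong_simp)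
qed

lemma levels_append_Ups:
  "level m (A @ replicate k Up) ` {0..length (A @ replicate k Up)} =
    level m A ` {0..length A} \<union> {int m + rise A..int m + rise A + int k}"
proof (induction k)
  case 0
  have "int m + rise A \<in> level m A ` {0..length A}"
    using level_length[of m A] by (metis atLeastAtMost_iff image_eqI le0 order_refl)
  then show ?case by auto
next
  case (Suc k)
  have *: "A @ replicate (Suc k) Up = (A @ replicate k Up) @ [Up]"
    by (simp add: replicate_append_same)
  show ?case unfolding * levels_snoc Suc by auto
qed

text \<open>A descent no longer than the preceding ascent only revisits levels of that
  ascent.\<close>

lemma levels_append_pyramid:
  assumes "j \<le> k"
  shows "level m (A @ replicate k Up @ replicate j Down) ` {0..length (A @ replicate k Up @ replicate j Down)} =
    level m A ` {0..length A} \<union> {int m + rise A..int m + rise A + int k}"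
  using assms
proof (induction j)
  case 0
  then show ?case using levels_append_Ups[of m A k] by simp
next
  case (Suc j)
  have *: "A @ replicate k Up @ replicate (Suc j) Down = (A @ replicate k Up @ replicate j Down) @ [Down]"
    by (simp add: replicate_append_same)
  show ?case unfolding * levels_snoc using Suc by auto
qed

text \<open>The pyramid returns to the level where it starts, so \<open>B\<close> is traversed at
  its old levels.\<close>

lemma levels_insert_pyramid:
  "level m (A @ replicate k Up @ replicate k Down @ B) `
      {0..length (A @ replicate k Up @ replicate k Down @ B)} =
    level m (A @ B) ` {0..length (A @ B)} \<union> {int m + rise A..int m + rise A + int k}"
proof (induction B rule: rev_induct)
  case Nil
  then show ?case using levels_append_pyramid[of k k m A] by simp
next
  case (snoc s B)
  have *: "A @ replicate k Up @ replicate k Down @ B @ [s] =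
      (A @ replicate k Up @ replicate k Down @ B) @ [s]" "A @ B @ [s] = (A @ B) @ [s]" by simp_all
  show ?case unfolding * levels_snoc snoc by auto
qed

text \<open>All added levels lie at or above the level after \<open>A\<close>, which is visited
  anyway, so the minimum is kept; the end level is kept because a pyramid has rise 0.\<close>

lemma paths_insert_pyramid:
  "A @ replicate k Up @ replicate k Down @ B \<in> paths m d \<longleftrightarrow> A @ B \<in> paths m d"
proof -
  let ?X = "level m (A @ B) ` {0..length (A @ B)}" and ?l = "int m + rise A"
  have "level m (A @ B) (length A) = ?l" by (simp add: level_def rise_def)
  then have l: "?l \<in> ?X" by (metis atLeastAtMost_iff image_eqI le0 le_add1 length_append)
  have "Min (?X \<union> {?l..?l + int k}) = min (Min ?X) (Min {?l..?l + int k})"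
    using l by (intro Min_Un) auto
  also have "Min {?l..?l + int k} = ?l" by (rule Min_eqI) auto
  also have "min (Min ?X) ?l = Min ?X" using Min_le[OF _ l] by simp
  finally show ?thesis
    unfolding paths_def levels_insert_pyramid mem_Collect_eq level_length by simp
qed

lemma flats_at_snoc:
  "flats_at m i (P @ [s]) = flats_at m i P + (if s = Flat \<and> int m + rise P = i then 1 else 0)"
proof -
  have "{k. k < length (P @ [s]) \<and> (P @ [s]) ! k = Flat \<and> level m (P @ [s]) k = i} =
      {k. k < length P \<and> P ! k = Flat \<and> level m P k = i} \<union>
      (if s = Flat \<and> int m + rise P = i then {length P} else {})"
    by (auto simp: less_Suc_eq nth_append level_snoc level_length)
  then show ?thesis
    unfolding flats_at_def by (simp add: card_insert_if)
qed

lemma flats_at_append_not_Flat: "Flat \<notin> set Q \<Longrightarrow> flats_at m i (P @ Q) = flats_at m i P"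
proof (induction Q rule: rev_induct)
  case (snoc s Q)
  then show ?case using flats_at_snoc[of m i "P @ Q" s] by auto
qed simp

text \<open>A pyramid contains no flatstep and does not move the level of later ones.\<close>

lemma flats_at_insert_pyramid:
  "flats_at m i (A @ replicate k Up @ replicate k Down @ B) = flats_at m i (A @ B)"
proof (induction B rule: rev_induct)
  case Nil
  then show ?case by (simp add: flats_at_append_not_Flat)
next
  case (snoc s B)
  then show ?case
    using flats_at_snoc[of m i "A @ B" s] flats_at_snoc[of m i "A @ replicate k Up @ replicate k Down @ B" s]
    by simp
qed

lemma flat_weight_insert_pyramid:
  "flat_weight m d (A @ replicate k Up @ replicate k Down @ B) = flat_weight m d (A @ B)"
  by (simp only: flat_weight_def flats_at_insert_pyramid)

theorem theorem18:
  fixes m d :: nat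
  shows "(1 - fps_X) * inv_1_minus_xy *
           (incl_y (g m d) oo (fps_X * (1 - fps_X) * inv_1_minus_xy)) = G m d"
proof (rule fps_ext)
  fix n
  \<comment> \<open>Membership in \<open>paths m d\<close> becomes part of the weight, which stays
    invariant because inserting a pyramid preserves membership.\<close>
  define w where "w = (\<lambda>P. if P \<in> paths m d then [:flat_weight m d P:] else 0)"
  define C where "C = (1 - fps_X) * inv_1_minus_xy"
  have inv: "pyramid_invariant w"
    by (simp only: pyramid_invariant_def w_def paths_insert_pyramid flat_weight_insert_pyramid simp_thms)
  have C: "(1 - fps_X * fps_const yvar) * C = 1 - fps_X"
    unfolding C_def mult.left_commute[of "1 - fps_X * fps_const yvar"] inv_1_minus_xy by simp
  have rise: "rise P = - int m" if "P \<in> paths m d" for P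
    using that by (simp add: paths_def level_length)
  have sum: "pa_sum y (- int m) w j =
      (\<Sum>P | P \<in> paths m d \<and> path_size P = j. y ^ pa P * [:flat_weight m d P:])" for y j
    unfolding pa_sum_def w_def
    by (rule sum.mono_neutral_cong_right)
      (use finite_rise_size_paths in \<open>auto simp: rise_size_paths_def rise\<close>)
  have G: "G m d $ j = pa_sum yvar (- int m) w j" for j
    by (simp add: sum G_def)
  \<comment> \<open>Evaluation at y = 1 removes the powers of y, and the inclusion as constant
    polynomials gives the same weighted sum with y = 1.\<close>
  have g: "incl_y (g m d) $ j = pa_sum 1 (- int m) w j" for j
    by (simp add: sum incl_y_def g_def G_def poly_sum yvar_def sum_to_poly)
  have "(C * (incl_y (g m d) oo (fps_X * C))) $ n = G m d $ n"
    unfolding mult_fps_compose_nth G g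
    by (rule pa_sum_expand[OF inv C inv_1_minus_xy, symmetric])
  then show "((1 - fps_X) * inv_1_minus_xy *
      (incl_y (g m d) oo (fps_X * (1 - fps_X) * inv_1_minus_xy))) $ n = G m d $ n"
    by (simp add: C_def mult.assoc)
qed

end
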